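(* Let $\mathcal{H}$ be a separable real Hilbert space, let $\mathcal{B}=\{e_n\}_n$ be an orthonormal basis of $\mathcal{H}$, and let $T$ be a bounded linear operator on $\mathcal{H}$. Then for every unitary operator $U$ on $\mathcal{H}$ the following hold: (a) $T$ is a P-operator on $\mathcal{H}$ relative to $\mathcal{B}$ if and only if the operator $UTU^*$ is a P-operator on $\mathcal{H}$ relative to the orthonormal basis $\mathcal{B}'=\{Ue_n\}_n$. (b) $T$ is a P-operator on $\mathcal{H}$ relative to the orthonormal basis $\mathcal{B}'=\{Ue_n\}_n$ if and only if the operator $U^*TU$ is a P-operator on $\mathcal{H}$ relative to $\mathcal{B}$.
   Context: $\mathcal{H}$ is a separable real Hilbert space with inner product $\langle\cdot,\cdot\rangle$; orthonormal bases are indexed by the natural numbers $n=1,2,3,\ldots$. An operator on $\mathcal{H}$ is a linear map from $\mathcal{H}$ into itself, and $U^*$ denotes the adjoint of $U$. A unitary operator on $\mathcal{H}$ is a bounded linear operator $U$ with $U^*U=UU^*=I$. Definition (P-operator). Let $\{f_n\}_n$ be an orthonormal basis of $\mathcal{H}$. A bounded linear operator $T$ on $\mathcal{H}$ is a P-operator relative to $\{f_n\}_n$ if, for every $x\in\mathcal{H}$, whenever $\langle x,f_n\rangle\langle Tx,f_n\rangle\le 0$ for all $n$, it follows that $x=0$. *)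

theory Defs
  imports "HOL-Analysis.Analysis"
begin

text \<open>
  Orthonormal bases are Hilbert (not Hamel) bases: the finite linear combinations of the
  basis vectors are required to be dense. The sequence \<open>n = 1, 2, 3, \<dots>\<close> is indexed from \<open>0\<close>.
\<close>

definition orthonormal_basis :: "(nat \<Rightarrow> 'a::real_inner) \<Rightarrow> bool"
  where "orthonormal_basis f \<longleftrightarrow>
    (\<forall>m n. f m \<bullet> f n = (if m = n then 1 else 0)) \<and> closure (span (range f)) = UNIV"

text \<open>
  Here \<^const>\<open>adjoint\<close> is defined by Hilbert choice from \<open>U x \<bullet> y = x \<bullet> U\<^sup>* y\<close>; for bounded linear
  operators on a complete space such a map exists by the Riesz representation theorem and is unique.
\<close>

definition unitary_operator :: "('a::real_inner \<Rightarrow> 'a) \<Rightarrow> bool"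
  where "unitary_operator U \<longleftrightarrow>
    bounded_linear U \<and> adjoint U \<circ> U = id \<and> U \<circ> adjoint U = id"

definition P_operator :: "(nat \<Rightarrow> 'a::real_inner) \<Rightarrow> ('a \<Rightarrow> 'a) \<Rightarrow> bool"
  where "P_operator f T \<longleftrightarrow>
    orthonormal_basis f \<and> bounded_linear T \<and>
    (\<forall>x. (\<forall>n. (x \<bullet> f n) * (T x \<bullet> f n) \<le> 0) \<longrightarrow> x = 0)"

end

theory Submission
  imports Defs
begin

text \<open>
  Since \<open>\<langle>Ux, Ue\<^sub>n\<rangle> = \<langle>x, e\<^sub>n\<rangle>\<close>, the sign conditions for \<open>T\<close> at \<open>x\<close> relative to \<open>e\<^sub>n\<close> are those for
  \<open>UTU\<^sup>*\<close> at \<open>Ux\<close> relative to \<open>Ue\<^sub>n\<close>; this is (a), and (b) is (a) applied to \<open>U\<^sup>*TU\<close>. The adjoint, being a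
  Hilbert choice, is known to exist only through the Riesz representation theorem. The latter is
  obtained by minimising \<open>J x = \<parallel>x\<parallel>\<^sup>2 - 2 \<phi> x\<close>: by the parallelogram law minimising sequences are
  Cauchy, and the minimum is attained at the representing vector.
\<close>

lemma riesz_representation:
  fixes \<phi> :: "'a::{real_inner, complete_space} \<Rightarrow> real"
  assumes "bounded_linear \<phi>"
  obtains z where "\<And>x. \<phi> x = z \<bullet> x"
proof -
  interpret \<phi>: bounded_linear \<phi> by fact
  \<comment> \<open>If \<open>z\<close> represents \<open>\<phi>\<close>, then \<open>J x\<close> is
    the square of \<open>norm (x - z)\<close> minus that of \<open>norm z\<close>, so
    \<open>z\<close> can only be the minimiser of \<open>J\<close>.\<close>
  define J where "J x = x \<bullet> x - 2 * \<phi> x" for x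
  define m where "m = Inf (range J)"
  obtain K where K: "\<And>x. norm (\<phi> x) \<le> norm x * K"
    using \<phi>.bounded by blast
  \<comment> \<open>Complete the square: \<open>J x\<close> is at least
    \<open>(norm x)\<^sup>2 - 2 * K * norm x\<close>.\<close>
  have "- K\<^sup>2 \<le> J x" for x
  proof -
    have "0 \<le> (norm x - K)\<^sup>2" by simp
    moreover have "\<phi> x \<le> norm x * K" using K[of x] by simp
    ultimately show ?thesis
      by (simp add: J_def dot_square_norm power2_eq_square algebra_simps)
  qed
  then have bdd: "bdd_below (range J)" by (rule bdd_belowI2)
  have m_le: "m \<le> J x" for x
    unfolding m_def using bdd by (simp add: cInf_lower)
  have "\<exists>x. J x < m + inverse (real (Suc n))" for n
    using cInf_lessD[of "range J" "m + inverse (real (Suc n))"] by (auto simp: m_def)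
  then obtain X where X: "\<And>n. J (X n) < m + inverse (real (Suc n))" by metis
  \<comment> \<open>By linearity the \<open>\<phi>\<close> terms of the two points and of their
    midpoint cancel, leaving the parallelogram law.\<close>
  have parallelogram: "(norm (x - y))\<^sup>2 = 2 * (J x + J y) - 4 * J ((1/2) *\<^sub>R (x + y))" for x y
    by (simp add: J_def \<phi>.scaleR \<phi>.add power2_norm_eq_inner inner_diff_left inner_diff_right
        inner_add_left inner_add_right inner_commute algebra_simps)
  have "Cauchy X"
  proof (rule metric_CauchyI)
    fix r :: real assume "0 < r"
    then obtain M where M: "inverse (real (Suc M)) < r\<^sup>2 / 4"
      using reals_Archimedean[of "r\<^sup>2 / 4"] by auto
    have "dist (X i) (X j) < r" if "M \<le> i" "M \<le> j" for i j
    proof -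
      \<comment> \<open>The midpoint has \<open>J\<close> at least \<open>m\<close>, so two values
        below \<open>m + r\<^sup>2 / 4\<close> bound the squared distance by
        \<open>2 * (2 * m + r\<^sup>2 / 2) - 4 * m = r\<^sup>2\<close>.\<close>
      have "J (X k) < m + r\<^sup>2 / 4" if "M \<le> k" for k
      proof -
        have "inverse (real (Suc k)) \<le> inverse (real (Suc M))"
          using that by (simp add: le_imp_inverse_le)
        then show ?thesis using X[of k] M by linarith
      qed
      from this[OF that(1)] this[OF that(2)]
      have "(norm (X i - X j))\<^sup>2 < r\<^sup>2"
        using m_le[of "(1/2) *\<^sub>R (X i + X j)"] unfolding parallelogram by argo
      then show ?thesis
        using \<open>0 < r\<close> by (simp add: dist_norm power2_less_imp_less)
    qed
    then show "\<exists>M. \<forall>i\<ge>M. \<forall>j\<ge>M. dist (X i) (X j) < r" by blast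
  qed
  then obtain z where z: "X \<longlonglongrightarrow> z"
    using Cauchy_convergent_iff convergent_def by blast
  have "(\<lambda>n. J (X n)) \<longlonglongrightarrow> J z"
    unfolding J_def by (intro tendsto_intros \<phi>.tendsto z)
  moreover have "(\<lambda>n. m + inverse (real (Suc n))) \<longlonglongrightarrow> m + 0"
    by (intro tendsto_intros LIMSEQ_inverse_real_of_nat)
  ultimately have "J z \<le> m + 0"
    using X by (intro LIMSEQ_le) (auto intro: less_imp_le)
  then have min: "J z \<le> J x" for x using m_le[of x] by simp
  have "\<phi> v = z \<bullet> v" for v
  proof (cases "v = 0")
    case False
    define c N where "c = z \<bullet> v - \<phi> v" and "N = v \<bullet> v"
    have "N > 0" using False by (simp add: N_def)
    have "J (z + t *\<^sub>R v) - J z = 2 * t * c + t\<^sup>2 * N" for t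
      by (simp add: J_def c_def N_def \<phi>.scaleR \<phi>.add inner_add_left inner_add_right
          inner_commute power2_eq_square algebra_simps)
    \<comment> \<open>The choice \<open>t = - c / N\<close> minimises the quadratic in
      \<open>t\<close>. Its value there is negative unless \<open>c = 0\<close>.\<close>
    then have "0 \<le> 2 * (- c / N) * c + (- c / N)\<^sup>2 * N"
      using min by (metis diff_ge_0_iff_ge)
    also have "\<dots> = - (c\<^sup>2 / N)"
      using \<open>N > 0\<close> by (simp add: power2_eq_square field_simps)
    finally have "c\<^sup>2 \<le> 0"
      using \<open>N > 0\<close> by (simp add: divide_le_0_iff)
    then show ?thesis by (simp add: c_def)
  qed (simp add: \<phi>.zero)
  then show thesis by (rule that)
qed

text \<open>For fixed \<open>y\<close>, Riesz applied to the functional sending \<open>x\<close> to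
  \<open>U x \<bullet> y\<close> yields the value at \<open>y\<close> of a possible adjoint, so the
  choice in \<open>adjoint\<close> has a witness.\<close>

lemma inner_adjoint:
  fixes U :: "'a::{real_inner, complete_space} \<Rightarrow> 'b::real_inner"
  assumes "bounded_linear U"
  shows "U x \<bullet> y = x \<bullet> adjoint U y"
proof -
  have "\<exists>z. \<forall>x. U x \<bullet> y = x \<bullet> z" for y
  proof -
    have "bounded_linear (\<lambda>x. U x \<bullet> y)"
      using bounded_linear_inner_left assms by (rule bounded_linear_compose)
    then show ?thesis
      by (rule riesz_representation) (metis inner_commute)
  qed
  then have "\<exists>g. \<forall>x y. U x \<bullet> y = x \<bullet> g y" by metis
  then show ?thesis
    unfolding adjoint_def by (rule someI2_ex) blast
qed

lemma unitary_operator_inner: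
  fixes U :: "'a::{real_inner, complete_space} \<Rightarrow> 'a"
  assumes "unitary_operator U"
  shows "U x \<bullet> U y = x \<bullet> y"
  using assms by (simp add: unitary_operator_def inner_adjoint pointfree_idE)

text \<open>As the two-sided inverse of \<open>U\<close>, the adjoint inherits linearity; since
  \<open>U\<close> is isometric, so is its inverse, which gives the bound 1.\<close>

lemma unitary_operator_bounded_linear_adjoint:
  fixes U :: "'a::{real_inner, complete_space} \<Rightarrow> 'a"
  assumes "unitary_operator U"
  shows "bounded_linear (adjoint U)"
proof -
  interpret U: bounded_linear U
    using assms by (simp add: unitary_operator_def)
  have left: "adjoint U (U x) = x" and right: "U (adjoint U x) = x" for x
    using assms by (simp_all add: unitary_operator_def pointfree_idE)
  show ?thesis
  proof (rule bounded_linear_intro)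
    show "adjoint U (x + y) = adjoint U x + adjoint U y" for x y
      by (metis U.add left right)
    show "adjoint U (r *\<^sub>R x) = r *\<^sub>R adjoint U x" for r x
      by (metis U.scaleR left right)
    show "norm (adjoint U x) \<le> norm x * 1" for x
      using unitary_operator_inner[OF assms, of "adjoint U x" "adjoint U x"]
      by (simp add: right norm_eq_sqrt_inner)
  qed
qed

text \<open>Orthonormality survives because inner products do. For density, \<open>U\<close> is onto
  and continuous, so it maps a dense span onto a dense span.\<close>

lemma orthonormal_basis_unitary:
  fixes e :: "nat \<Rightarrow> 'a::{real_inner, complete_space}"
  assumes "unitary_operator U" "orthonormal_basis e"
  shows "orthonormal_basis (\<lambda>n. U (e n))"
proof -
  have U: "bounded_linear U" and "U \<circ> adjoint U = id"
    using assms(1) by (simp_all add: unitary_operator_def)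
  then have "surj U"
    using surjI[of U "adjoint U"] by (simp add: fun_eq_iff)
  have "UNIV = U ` closure (span (range e))"
    using assms(2) \<open>surj U\<close> by (simp add: orthonormal_basis_def)
  also have "\<dots> \<subseteq> closure (U ` span (range e))"
    using closure_bounded_linear_image_subset[OF U] .
  also have "U ` span (range e) = span (range (\<lambda>n. U (e n)))"
    using linear_span_image[OF bounded_linear.linear[OF U], of "range e"] by (simp add: image_image)
  finally show ?thesis
    using assms by (auto simp: orthonormal_basis_def unitary_operator_inner)
qed

lemma P_operator_unitary_conjugate:
  fixes e :: "nat \<Rightarrow> 'a::{real_inner, complete_space}"
  assumes U: "unitary_operator U" and e: "orthonormal_basis e" and T: "bounded_linear T"
  shows "P_operator e T \<longleftrightarrow> P_operator (\<lambda>n. U (e n)) (U \<circ> T \<circ> adjoint U)"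
proof -
  have left: "adjoint U (U x) = x" and right: "U (adjoint U x) = x" and lin: "bounded_linear U" for x
    using U by (simp_all add: unitary_operator_def pointfree_idE)
  have "bounded_linear (U \<circ> T \<circ> adjoint U)"
    unfolding o_def
    by (intro bounded_linear_compose[OF lin] bounded_linear_compose[OF T]
        unitary_operator_bounded_linear_adjoint U)
  moreover have "(\<forall>x. (\<forall>n. (x \<bullet> e n) * (T x \<bullet> e n) \<le> 0) \<longrightarrow> x = 0) \<longleftrightarrow>
    (\<forall>y. (\<forall>n. (y \<bullet> U (e n)) * ((U \<circ> T \<circ> adjoint U) y \<bullet> U (e n)) \<le> 0) \<longrightarrow> y = 0)"
    (is "(\<forall>x. ?P x) \<longleftrightarrow> (\<forall>y. ?Q y)")
  proof -
    \<comment> \<open>Substitute \<open>y = U x\<close>: by \<open>right\<close> every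
      \<open>y\<close> has this form, and by injectivity the conclusions \<open>y = 0\<close> and
      \<open>x = 0\<close> agree.\<close>
    have "U x = 0 \<longleftrightarrow> x = 0" for x
      by (metis left linear_0 lin bounded_linear.linear)
    then have "?Q (U x) \<longleftrightarrow> ?P x" for x
      by (simp add: left unitary_operator_inner[OF U])
    then show ?thesis by (metis right)
  qed
  ultimately show ?thesis
    using e T orthonormal_basis_unitary[OF U e] by (simp add: P_operator_def)
qed

theorem theorem2p10:
  fixes e :: "nat \<Rightarrow> 'a::{real_inner, complete_space}"
    and T U :: "'a \<Rightarrow> 'a"
  assumes "separable_space (euclidean :: 'a topology)"
    and "orthonormal_basis e"
    and "bounded_linear T"
    and "unitary_operator U"
  shows "(P_operator e T \<longleftrightarrow> P_operator (\<lambda>n. U (e n)) (U \<circ> T \<circ> adjoint U)) \<and>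
    (P_operator (\<lambda>n. U (e n)) T \<longleftrightarrow> P_operator e (adjoint U \<circ> T \<circ> U))"
proof
  show "P_operator e T \<longleftrightarrow> P_operator (\<lambda>n. U (e n)) (U \<circ> T \<circ> adjoint U)"
    using assms by (intro P_operator_unitary_conjugate)
  have "bounded_linear (adjoint U \<circ> T \<circ> U)"
    using assms(4) unfolding o_def
    by (intro bounded_linear_compose[OF unitary_operator_bounded_linear_adjoint]
        bounded_linear_compose[OF assms(3)])
      (simp_all add: unitary_operator_def)
  moreover have "U \<circ> (adjoint U \<circ> T \<circ> U) \<circ> adjoint U = T"
    using assms(4) by (simp add: unitary_operator_def fun_eq_iff)
  ultimately show "P_operator (\<lambda>n. U (e n)) T \<longleftrightarrow> P_operator e (adjoint U \<circ> T \<circ> U)"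
    using P_operator_unitary_conjugate[OF assms(4,2), of "adjoint U \<circ> T \<circ> U"] by simp
qed

end
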